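(* Let $(X_i)_{i\in\mathbb{Z}}$ be a sequence of random elements in some Banach space $\mathbb{E}$, with strong mixing coefficients $(\alpha_n)_{n\ge0}$. Let $T$ be an arbitrary index set and, for $i\in\mathbb{Z}$, let $G_i\in\ell^\infty(\mathbb{E}\times T)$. For $t\in T$, set $Y_i(t)=G_i(X_i,t)$, $S_n(t)=\sum_{i=1}^nY_i(t)$ for $n\ge1$, and $S_0\equiv0$. For $f\in\ell^\infty(T)$ let $\|f\|=\sup_{t\in T}|f(t)|$. Suppose that $\|S_m-S_n\|$ is measurable for each $0\le n<m$. Then, for each $\varepsilon>0$ and all integers $1\le\ell<n$, $$\mathbb{P}\Bigl(\max_{1\le k\le n}\|S_k\|>3\varepsilon\Bigr)\times\Bigl\{1-\max_{1\le k\le n}\mathbb{P}\bigl(\|S_n-S_k\|>\varepsilon\bigr)\Bigr\}$$ $$\le\ \mathbb{P}\bigl(\|S_n\|>\varepsilon\bigr)+\mathbb{P}\Bigl(\max_{\substack{j<k\in\{1,\dots,n\}\\ k-j\le2\ell}}\|S_k-S_j\|>\varepsilon\Bigr)+\lfloor n/\ell\rfloor\,\alpha_\ell,$$ where the maximum in the second term on the right is over all $j,k\in\{1,\dots,n\}$ with $j<k$ and $k-j\le2\ell$.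
   Context: $\ell^\infty(A)$ denotes the space of bounded real-valued functions on a set $A$, and $\lfloor x\rfloor$ is the integer part of $x$. Strong mixing coefficients: for $a\le b$ with $a,b\in\mathbb{Z}\cup\{-\infty,\infty\}$, let $\mathcal{F}_a^b$ be the $\sigma$-field generated by $(X_i)_{a\le i\le b}$. The strong mixing coefficients of the sequence $(X_i)_{i\in\mathbb{Z}}$ are $\alpha_0=1/2$ and, for $n\ge1$, $$\alpha_n=\sup_{p\in\mathbb{Z}}\ \sup_{A\in\mathcal{F}_{-\infty}^p,\,B\in\mathcal{F}_{p+n}^{+\infty}}|\mathbb{P}(A\cap B)-\mathbb{P}(A)\mathbb{P}(B)|.$$
   Formalization: The norm of S_m − S_n is assumed measurable with respect to the σ-field generated by X_{n+1},…,X_m, not merely measurable; with only ambient measurability and non-measurable G_i the inequality can fail. *)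

theory Defs
  imports "HOL-Probability.Probability"
begin

text \<open>
  \<open>gen_field M X I\<close> is the \<open>\<sigma>\<close>-field generated by \<open>(X i)\<close> for \<open>i \<in> I\<close>, on the sample space
  of \<open>M\<close>. The \<open>\<sigma>\<close>-field \<open>F_a^b\<close> is the case \<open>I = {a..b}\<close>; an infinite endpoint gives
  \<open>{..b}\<close> or \<open>{a..}\<close>.
\<close>

definition gen_field ::
  "'w measure \<Rightarrow> (int \<Rightarrow> 'w \<Rightarrow> 'e::topological_space) \<Rightarrow> int set \<Rightarrow> 'w measure" where
  "gen_field M X I = sigma (space M) (\<Union>i\<in>I. {X i -` B \<inter> space M | B. B \<in> sets borel})"

definition strong_mixing_coeff ::
  "'w measure \<Rightarrow> (int \<Rightarrow> 'w \<Rightarrow> 'e::topological_space) \<Rightarrow> nat \<Rightarrow> real" where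
  "strong_mixing_coeff M X n =
     (if n = 0 then 1 / 2
      else SUP p::int. SUP (A, B) \<in> sets (gen_field M X {..p}) \<times> sets (gen_field M X {p + int n..}).
             \<bar>measure M (A \<inter> B) - measure M A * measure M B\<bar>)"

text \<open>
  Functions on a set \<open>A\<close> are total functions whose values outside \<open>A\<close> are ignored. The supremum
  norm is a supremum in the nonnegative reals, hence \<open>0\<close> for \<open>A = {}\<close>, where the value of
  \<open>Sup\<close> on the reals would be meaningless.
\<close>

definition linf :: "'a set \<Rightarrow> ('a \<Rightarrow> real) set" where
  "linf A = {f. bounded (f ` A)}"

definition linf_norm :: "'a set \<Rightarrow> ('a \<Rightarrow> real) \<Rightarrow> real" where
  "linf_norm A f = (if A = {} then 0 else SUP t\<in>A. \<bar>f t\<bar>)"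

definition partial_sum ::
  "(int \<Rightarrow> 'e \<times> 't \<Rightarrow> real) \<Rightarrow> (int \<Rightarrow> 'w \<Rightarrow> 'e) \<Rightarrow> nat \<Rightarrow> 'w \<Rightarrow> 't \<Rightarrow> real" where
  "partial_sum G X n \<omega> t = (\<Sum>i=1..n. G (int i) (X (int i) \<omega>, t))"

end

theory Submission imports Defs begin

text \<open>
  This is Ottaviani's maximal inequality with independence replaced by strong mixing. For
  independent summands one stops at the first \<open>k\<close> with \<open>\<parallel>S k\<parallel> > 3\<epsilon>\<close>: if the rest
  \<open>S n - S k\<close>, which is independent of the past, has norm at most \<open>\<epsilon>\<close>, then
  \<open>\<parallel>S n\<parallel>\<close> is still large. Under mixing the rest is only nearly independent of the past, and
  only after a gap of length \<open>l\<close>. So the stopping time is localised to one of \<open>m = \<lfloor>n / l\<rfloor>\<close>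
  blocks of length \<open>l\<close> (the last one also takes the remainder \<open>n mod l\<close>), and the rest is started
  at \<open>v\<close>, one whole block after the end of the block that contains the stopping time \<open>k\<close>. Since
  \<open>v - k \<le> 2 l\<close>, replacing \<open>S k\<close> by \<open>S v\<close> costs at most \<open>\<epsilon>\<close> unless the event in the second term
  on the right occurs. So the hypothesis \<open>\<parallel>S k\<parallel> > 3\<epsilon>\<close> leaves \<open>\<parallel>S v\<parallel> > 2\<epsilon>\<close> and then \<open>\<parallel>S n\<parallel> > \<epsilon>\<close>.

  Each block costs one covariance, hence at most \<open>\<alpha>\<^sub>l\<close> (\<open>strong_mixing_coeff_bound\<close>), and
  summing over the disjoint events of stopping in a given block yields the factor \<open>m\<close>
  (\<open>sum_over_disjoint_events\<close>). In the last block there is no room for a gap, but \<open>n\<close> itself is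
  within \<open>2 l\<close> of \<open>k\<close>, so \<open>v = n\<close> works and the rest is \<open>0\<close>.
\<close>

lemma linf_norm_triangle:
  assumes "f \<in> linf T" "g \<in> linf T"
  shows "linf_norm T f \<le> linf_norm T g + linf_norm T (\<lambda>t. g t - f t)"
proof (cases "T = {}")
  case True
  then show ?thesis by (simp add: linf_norm_def)
next
  case False
  obtain a where a: "\<And>t. t \<in> T \<Longrightarrow> \<bar>f t\<bar> \<le> a"
    using assms(1) by (auto simp: linf_def bounded_iff)
  obtain b where b: "\<And>t. t \<in> T \<Longrightarrow> \<bar>g t\<bar> \<le> b"
    using assms(2) by (auto simp: linf_def bounded_iff)
  have bdd_g: "bdd_above ((\<lambda>t. \<bar>g t\<bar>) ` T)"
    by (rule bdd_aboveI2) (rule b)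
  have bdd_diff: "bdd_above ((\<lambda>t. \<bar>g t - f t\<bar>) ` T)"
  proof (rule bdd_aboveI2)
    show "\<bar>g t - f t\<bar> \<le> a + b" if "t \<in> T" for t
      using a[OF that] b[OF that] by linarith
  qed
  have "(SUP t\<in>T. \<bar>f t\<bar>) \<le> (SUP t\<in>T. \<bar>g t\<bar>) + (SUP t\<in>T. \<bar>g t - f t\<bar>)"
  proof (rule cSUP_least[OF False])
    fix t assume t: "t \<in> T"
    show "\<bar>f t\<bar> \<le> (SUP t\<in>T. \<bar>g t\<bar>) + (SUP t\<in>T. \<bar>g t - f t\<bar>)"
      using cSUP_upper[OF t bdd_g] cSUP_upper[OF t bdd_diff] by linarith
  qed
  then show ?thesis using False by (simp add: linf_norm_def)
qed

lemma partial_sum_in_linf: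
  assumes "\<And>i. G i \<in> linf (UNIV \<times> T)"
  shows "partial_sum G X n \<omega> \<in> linf T"
proof (induction n)
  case 0
  then show ?case by (auto simp: linf_def partial_sum_def[abs_def] bounded_iff)
next
  case (Suc n)
  have "bounded ((\<lambda>t. G (int (Suc n)) (X (int (Suc n)) \<omega>, t)) ` T)"
  proof (rule bounded_subset)
    show "bounded (G (int (Suc n)) ` (UNIV \<times> T))"
      using assms by (simp add: linf_def)
  qed auto
  with Suc show ?case
    by (simp add: linf_def partial_sum_def[abs_def] bounded_plus_comp)
qed

lemma space_gen_field [simp]: "space (gen_field M X I) = space M"
  by (simp add: gen_field_def space_measure_of_conv)

lemma sets_gen_field:
  "sets (gen_field M X I) =
     sigma_sets (space M) (\<Union>i\<in>I. {X i -` B \<inter> space M | B. B \<in> sets borel})"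
  unfolding gen_field_def by (rule sets_measure_of) auto

lemma sets_gen_field_mono:
  "I \<subseteq> J \<Longrightarrow> sets (gen_field M X I) \<subseteq> sets (gen_field M X J)"
  unfolding sets_gen_field by (rule sigma_sets_mono') blast

lemma sets_gen_field_subset:
  assumes "\<And>i. X i \<in> M \<rightarrow>\<^sub>M borel"
  shows "sets (gen_field M X I) \<subseteq> sets M"
  unfolding sets_gen_field
  by (rule sets.sigma_sets_subset) (auto intro: measurable_sets[OF assms])

text \<open>
  The real-valued suprema in the definition of the mixing coefficients are meaningful because
  all the covariances are bounded by \<open>1\<close>.
\<close>

lemma strong_mixing_coeff_bound:
  assumes "prob_space M" and "n \<noteq> 0"
    and A: "A \<in> sets (gen_field M X {..p})" and B: "B \<in> sets (gen_field M X {p + int n..})"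
  shows "\<bar>measure M (A \<inter> B) - measure M A * measure M B\<bar> \<le> strong_mixing_coeff M X n"
proof -
  interpret prob_space M by fact
  define cov where "cov = (\<lambda>(A, B). \<bar>prob (A \<inter> B) - prob A * prob B\<bar>)"
  define R where
    "R p = sets (gen_field M X {..p}) \<times> sets (gen_field M X {p + int n..})" for p
  have cov_le: "cov x \<le> 1" for x
  proof (cases x)
    case (Pair A B)
    have "prob A * prob B \<le> 1" by (simp add: mult_le_one)
    moreover have "0 \<le> prob A * prob B" "0 \<le> prob (A \<inter> B)" "prob (A \<inter> B) \<le> 1" by simp_all
    ultimately show ?thesis unfolding Pair cov_def prod.case by linarith
  qed
  have R_ne: "R p \<noteq> {}" for p unfolding R_def by blast
  have "cov (A, B) \<le> (SUP x\<in>R p. cov x)"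
    by (rule cSUP_upper) (use A B cov_le in \<open>auto simp: R_def intro!: bdd_aboveI2\<close>)
  also have "\<dots> \<le> (SUP p. SUP x\<in>R p. cov x)"
    by (rule cSUP_upper) (use cov_le R_ne in \<open>auto intro!: bdd_aboveI2 cSUP_least\<close>)
  also have "\<dots> = strong_mixing_coeff M X n"
    using \<open>n \<noteq> 0\<close> by (simp add: strong_mixing_coeff_def cov_def R_def)
  finally show ?thesis by (simp add: cov_def)
qed

text \<open>
  The probabilistic half of Ottaviani's argument: \<open>E j\<close> is the event of stopping in the \<open>j\<close>-th
  block and \<open>B j\<close> says that the rest after that block is small. The \<open>E j \<inter> B j\<close> are disjoint, so
  the mass of all of them together is at most that of \<open>D\<close>, and only the covariance errors add up.
\<close>

lemma (in prob_space) sum_over_disjoint_events: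
  fixes m :: nat
  assumes E: "\<And>j. j < m \<Longrightarrow> E j \<in> events" and B: "\<And>j. j < m \<Longrightarrow> B j \<in> events"
    and D: "D \<in> events"
    and disj: "disjoint_family_on E {..<m}"
    and cov: "\<And>j. j < m \<Longrightarrow> prob (E j) * prob (B j) \<le> prob (E j \<inter> B j) + a"
    and q: "\<And>j. j < m \<Longrightarrow> q \<le> prob (B j)"
    and sub: "\<And>j. j < m \<Longrightarrow> E j \<inter> B j \<subseteq> D"
  shows "prob (\<Union>j<m. E j) * q \<le> prob D + real m * a"
proof -
  have "prob (\<Union>j<m. E j) * q = (\<Sum>j<m. prob (E j) * q)"
    using E disj by (subst finite_measure_finite_Union) (auto simp: sum_distrib_right)
  also have "\<dots> \<le> (\<Sum>j<m. prob (E j \<inter> B j) + a)"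
  proof (rule sum_mono)
    fix j assume "j \<in> {..<m}"
    then have "j < m" by simp
    have "prob (E j) * q \<le> prob (E j) * prob (B j)"
      by (intro mult_left_mono q \<open>j < m\<close>) simp
    also note cov[OF \<open>j < m\<close>]
    finally show "prob (E j) * q \<le> prob (E j \<inter> B j) + a" .
  qed
  also have "\<dots> = prob (\<Union>j<m. E j \<inter> B j) + real m * a"
  proof (subst finite_measure_finite_Union)
    show "disjoint_family_on (\<lambda>j. E j \<inter> B j) {..<m}"
      using disj by (rule disjoint_family_on_bisimulation) auto
  qed (use E B in \<open>auto simp: sum.distrib\<close>)
  also have "\<dots> \<le> prob D + real m * a"
    using sub by (intro add_right_mono finite_measure_mono D) blast
  finally show ?thesis .
qed

theorem lemma3:
  fixes M :: "'w measure"
    and X :: "int \<Rightarrow> 'w \<Rightarrow> 'e::banach"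
    and T :: "'t set"
    and G :: "int \<Rightarrow> 'e \<times> 't \<Rightarrow> real"
    and S :: "nat \<Rightarrow> 'w \<Rightarrow> 't \<Rightarrow> real"
    and \<epsilon> :: real
    and l n :: nat
  defines "S \<equiv> partial_sum G X"
  assumes "prob_space M"
    and "\<And>i. X i \<in> M \<rightarrow>\<^sub>M borel"
    and "\<And>i. G i \<in> linf (UNIV \<times> T)"
    \<comment> \<open>The norm of \<open>S b - S a\<close> is a function of \<open>X (a + 1), \<dots>, X b\<close> only, and it is measurable
        as such. Measurability with respect to \<open>M\<close> alone would not be enough, since the \<open>G i\<close>
        need not be measurable and the mixing coefficients only see the \<open>\<sigma>\<close>-fields generated
        by \<open>X\<close>.\<close>
    and "\<And>a b. a < b \<Longrightarrow>
           (\<lambda>\<omega>. linf_norm T (\<lambda>t. S b \<omega> t - S a \<omega> t))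
             \<in> borel_measurable (gen_field M X {int a + 1..int b})"
    and "\<epsilon> > 0"
    and "1 \<le> l" and "l < n"
  shows "measure M {\<omega> \<in> space M. (MAX k\<in>{1..n}. linf_norm T (S k \<omega>)) > 3 * \<epsilon>}
           * (1 - (MAX k\<in>{1..n}.
                 measure M {\<omega> \<in> space M. linf_norm T (\<lambda>t. S n \<omega> t - S k \<omega> t) > \<epsilon>}))
         \<le> measure M {\<omega> \<in> space M. linf_norm T (S n \<omega>) > \<epsilon>}
           + measure M {\<omega> \<in> space M.
               (MAX (j, k)\<in>{(j, k). j \<in> {1..n} \<and> k \<in> {1..n} \<and> j < k \<and> k - j \<le> 2 * l}.
                  linf_norm T (\<lambda>t. S k \<omega> t - S j \<omega> t)) > \<epsilon>}
           + of_int \<lfloor>real n / real l\<rfloor> * strong_mixing_coeff M X l"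
proof -
  interpret prob_space M by fact
  note X = assms(3) and G = assms(4) and meas = assms(5)
  note \<epsilon> = \<open>\<epsilon> > 0\<close> and l = \<open>1 \<le> l\<close> \<open>l < n\<close>
  define N where "N a b \<omega> = linf_norm T (\<lambda>t. S b \<omega> t - S a \<omega> t)" for a b \<omega>
  have N_eq: "linf_norm T (S k \<omega>) = N 0 k \<omega>" for k \<omega>
    by (simp add: N_def S_def partial_sum_def[abs_def])
  have N_same: "N a a \<omega> = 0" for a \<omega>
    by (simp add: N_def linf_norm_def)
  have N_triangle: "N 0 a \<omega> \<le> N 0 b \<omega> + N a b \<omega>" for a b \<omega>
    using linf_norm_triangle[OF partial_sum_in_linf[OF G] partial_sum_in_linf[OF G]]
    unfolding N_eq[symmetric] unfolding N_def S_def .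
  have N_meas: "{\<omega> \<in> space M. N a b \<omega> > c} \<in> sets (gen_field M X I)"
    if "{int a + 1..int b} \<subseteq> I" "a \<le> b" for a b c I
  proof (cases "a = b")
    case True
    then show ?thesis
      using sets.top[of "gen_field M X I"] by (simp add: N_same)
  next
    case False
    then have "N a b \<in> borel_measurable (gen_field M X {int a + 1..int b})"
      using that meas unfolding N_def[abs_def] by simp
    then have "{\<omega> \<in> space (gen_field M X {int a + 1..int b}). N a b \<omega> > c}
        \<in> sets (gen_field M X {int a + 1..int b})"
      by measurable
    then show ?thesis using sets_gen_field_mono[OF that(1)] by auto
  qed
  note gen_events = sets_gen_field_subset[OF X, THEN subsetD]
  have N_event: "{\<omega> \<in> space M. N a b \<omega> > c} \<in> events" if "a \<le> b" for a b c
    by (rule gen_events[OF N_meas[OF order_refl that]])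

  define m where "m = n div l"
  have m: "0 < m" "m * l \<le> n" "n < (m + 1) * l"
    using l dividend_less_div_times[of l n] by (auto simp: m_def div_greater_zero_iff)
  \<comment> \<open>Block \<open>j\<close> is \<open>{u j<..u (Suc j)}\<close>, and the rest after it starts at \<open>v j\<close>. The value \<open>n\<close> lets
      the last block absorb \<open>n mod l\<close>, and makes the rest after it empty.\<close>
  define u where "u j = (if j < m then j * l else n)" for j
  define v where "v j = (if j + 1 < m then (j + 2) * l else n)" for j
  have mult_le_m: "i * l \<le> n" if "i \<le> m" for i
    using that m(2) by (meson le_trans mult_le_mono1)
  have u_le: "u j \<le> n" for j
    unfolding u_def using mult_le_m[of j] by auto
  have v_le: "v j \<le> n" for j
    unfolding v_def using mult_le_m[of "j + 2"] by auto
  have v_pos: "1 \<le> v j" for j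
    using l by (auto simp: v_def)
  have u_mono: "mono u"
    unfolding u_def[abs_def] by (rule monoI) (use mult_le_m in \<open>auto intro: mult_le_mono1\<close>)
  have u_le_v: "u (Suc j) \<le> v j" if "j < m" for j
    using that by (auto simp: u_def v_def)
  have v_near: "v j \<le> k + 2 * l" if "j < m" "u j < k" for j k
  proof (cases "j + 1 < m")
    case False
    then have "m = j + 1" using that by simp
    with that m(3) show ?thesis by (simp add: u_def v_def)
  qed (use that in \<open>simp add: u_def v_def\<close>)

  \<comment> \<open>The stopping time lies in block \<open>j\<close> iff \<open>3 * \<epsilon>\<close> is exceeded by the end of that block but not
      before it. With \<open>E\<close> as differences of the increasing \<open>H\<close>, the stopping time itself need not
      be defined.\<close>
  define H where "H j = (\<Union>k\<in>{1..u j}. {\<omega> \<in> space M. N 0 k \<omega> > 3 * \<epsilon>})" for j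
  define E where "E j = H (Suc j) - H j" for j
  define B where "B j = space M - {\<omega> \<in> space M. N (v j) n \<omega> > \<epsilon>}" for j
  define P where "P = {(j, k). j \<in> {1..n} \<and> k \<in> {1..n} \<and> j < k \<and> k - j \<le> 2 * l}"
  define D1 where "D1 = {\<omega> \<in> space M. N 0 n \<omega> > \<epsilon>}"
  define D2 where "D2 = (\<Union>(j, k)\<in>P. {\<omega> \<in> space M. N j k \<omega> > \<epsilon>})"
  define c where "c = (MAX k\<in>{1..n}. prob {\<omega> \<in> space M. N k n \<omega> > \<epsilon>})"

  have P_fin: "finite P"
    by (rule finite_subset[of _ "{1..n} \<times> {1..n}"]) (auto simp: P_def)
  have "(1, 2) \<in> P" using l by (simp add: P_def)
  then have P_ne: "P \<noteq> {}" by blast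
  have H_max: "H m = {\<omega> \<in> space M. (MAX k\<in>{1..n}. linf_norm T (S k \<omega>)) > 3 * \<epsilon>}"
    using l by (auto simp: H_def u_def N_eq Max_gr_iff)
  have D2_max: "D2 = {\<omega> \<in> space M. (MAX (j, k)\<in>P. N j k \<omega>) > \<epsilon>}"
  proof -
    have "(MAX (j, k)\<in>P. N j k \<omega>) > \<epsilon> \<longleftrightarrow> (\<exists>(j, k)\<in>P. N j k \<omega> > \<epsilon>)" for \<omega>
      using P_fin P_ne by (subst Max_gr_iff) (auto simp: case_prod_unfold)
    then show ?thesis unfolding D2_def by auto
  qed
  have H_mono: "mono H"
    unfolding H_def[abs_def] using u_mono[THEN monoD]
    by (intro monoI UN_mono) (auto intro: order_trans)
  have H_union: "(\<Union>j<i. E j) = H i" for i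
  proof (induction i)
    case 0
    show ?case using m(1) by (simp add: H_def u_def)
  next
    case (Suc i)
    then show ?case
      using monoD[OF H_mono, of i "Suc i"] by (auto simp: E_def lessThan_Suc)
  qed
  have disj: "disjoint_family_on E {..<m}"
  proof -
    have "E i \<inter> E j = {}" if "i < j" for i j
      using monoD[OF H_mono, of "Suc i" j] that by (auto simp: E_def)
    then show ?thesis
      unfolding disjoint_family_on_def by (metis inf_commute linorder_neqE_nat)
  qed

  have H_past: "H j \<in> sets (gen_field M X {..p})" if "int (u j) \<le> p" for j p
    unfolding H_def by (intro sets.finite_UN N_meas) (use that in auto)
  have E_past: "E j \<in> sets (gen_field M X {..int (u (Suc j))})" for j
    unfolding E_def using monoD[OF u_mono, of j "Suc j"]
    by (intro sets.Diff H_past) auto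
  have B_future: "B j \<in> sets (gen_field M X {int (v j) + 1..})" for j
  proof -
    have "{\<omega> \<in> space M. N (v j) n \<omega> > \<epsilon>} \<in> sets (gen_field M X {int (v j) + 1..})"
      by (rule N_meas) (use v_le in auto)
    from sets.compl_sets[OF this] show ?thesis by (simp add: B_def)
  qed
  have D1_event: "D1 \<in> events"
    unfolding D1_def by (rule N_event) simp
  have D2_event: "D2 \<in> events"
    unfolding D2_def using P_fin
    by (intro sets.finite_UN) (auto simp: P_def intro!: N_event)
  have mixing_nonneg: "0 \<le> strong_mixing_coeff M X l"
    using strong_mixing_coeff_bound[OF \<open>prob_space M\<close>, of l "{}" X 0 "{}"] l by simp

  have "prob (\<Union>j<m. E j) * (1 - c) \<le> prob (D1 \<union> D2) + real m * strong_mixing_coeff M X l"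
  proof (rule sum_over_disjoint_events[OF _ _ _ disj])
    show "E j \<in> events" "B j \<in> events" for j
      by (fact gen_events[OF E_past]) (fact gen_events[OF B_future])
    show "D1 \<union> D2 \<in> events" using D1_event D2_event by blast
    show "1 - c \<le> prob (B j)" for j
    proof -
      have "prob {\<omega> \<in> space M. N (v j) n \<omega> > \<epsilon>} \<le> c"
        unfolding c_def using v_le v_pos by (intro Max_ge) auto
      moreover have "prob (B j) = 1 - prob {\<omega> \<in> space M. N (v j) n \<omega> > \<epsilon>}"
        unfolding B_def by (rule prob_compl) (rule N_event[OF v_le])
      ultimately show ?thesis by simp
    qed
    show "prob (E j) * prob (B j) \<le> prob (E j \<inter> B j) + strong_mixing_coeff M X l"
      if "j < m" for j
    proof (cases "j + 1 < m")
      case True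
      have "{int (v j) + 1..} \<subseteq> {int (u (Suc j)) + int l..}"
        using True by (auto simp: u_def v_def)
      then have "B j \<in> sets (gen_field M X {int (u (Suc j)) + int l..})"
        using B_future sets_gen_field_mono by blast
      from strong_mixing_coeff_bound[OF \<open>prob_space M\<close> _ E_past this] l show ?thesis by simp
    next
      case False
      then have "B j = space M" using \<epsilon> by (auto simp: B_def v_def N_same)
      moreover have "E j \<inter> space M = E j"
        using gen_events[OF E_past[of j]] by (rule sets.Int_space_eq2)
      ultimately show ?thesis
        using mixing_nonneg by (simp add: prob_space)
    qed
    show "E j \<inter> B j \<subseteq> D1 \<union> D2" if "j < m" for j
    proof
      fix \<omega> assume "\<omega> \<in> E j \<inter> B j"
      then obtain k where k: "1 \<le> k" "k \<le> u (Suc j)" "N 0 k \<omega> > 3 * \<epsilon>" "\<not> k \<le> u j"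
        and \<omega>: "\<omega> \<in> space M" and rest: "N (v j) n \<omega> \<le> \<epsilon>"
        by (auto simp: E_def H_def B_def)
      show "\<omega> \<in> D1 \<union> D2"
      proof (rule ccontr)
        assume no: "\<omega> \<notin> D1 \<union> D2"
        have "N k (v j) \<omega> \<le> \<epsilon>"
        proof (cases "k = v j")
          case True
          then show ?thesis using \<epsilon> by (simp add: N_same)
        next
          case False
          have "(k, v j) \<in> P"
            unfolding P_def
            using k False u_le_v[OF that] u_le[of "Suc j"] v_le[of j] v_pos[of j]
              v_near[OF that, of k]
            by auto
          then show ?thesis using no \<omega> by (force simp: D2_def)
        qed
        moreover have "N 0 n \<omega> \<le> \<epsilon>" using no \<omega> by (simp add: D1_def)
        ultimately show False
          using k(3) rest N_triangle[of k \<omega> "v j"] N_triangle[of "v j" \<omega> n] by linarith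
      qed
    qed
  qed
  also have "prob (D1 \<union> D2) \<le> prob D1 + prob D2"
    by (rule measure_Un_le[OF D1_event D2_event])
  finally have "prob (H m) * (1 - c) \<le> prob D1 + prob D2 + real m * strong_mixing_coeff M X l"
    by (simp add: H_union)
  moreover have "of_int \<lfloor>real n / real l\<rfloor> = real m"
    by (simp add: m_def floor_divide_of_nat_eq)
  ultimately show ?thesis
    unfolding H_max D2_max D1_def c_def P_def N_eq[symmetric] unfolding N_def by simp
qed

end
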